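(* Let $N = p^k m^2$ be an odd perfect number, where $p$ is a prime with $p \equiv k \equiv 1 \pmod 4$, $k$ a positive integer, $m$ a positive integer and $\gcd(p,m)=1$. Set $\rho_3 = \sigma(p^k)/m$ and $\mu_4 = \sigma(m)/p^k$. Then $\rho_3 \neq \mu_4$, and: (i) if $\rho_3 < 1$, then $p^k < m$; (ii) if $1 < \rho_3$ and $\rho_3 < \mu_4$, then $\frac{4}{5}m < p^k < \sqrt{2}\,m$; (iii) if $1 < \rho_3$ and $\mu_4 < \rho_3$, then $m < p^k$.
   Context: $\sigma(n)$ denotes the sum of the positive divisors of $n$. An odd perfect number is an odd positive integer $N$ with $\sigma(N)=2N$. *)

theory Defs
  imports Complex_Main "HOL-Number_Theory.Number_Theory"
begin

definition sigma :: "nat \<Rightarrow> nat" where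
  "sigma n = (\<Sum>d | d dvd n. d)"

definition odd_perfect :: "nat \<Rightarrow> bool" where
  "odd_perfect N \<longleftrightarrow> N > 0 \<and> odd N \<and> sigma N = 2 * N"

end

theory Submission
  imports Defs
begin

text \<open>
  Put q = p^k. Since p is at least 5, q < \<sigma>(q) < 5q/4, and so \<sigma>(q)\<sigma>(m^2) = 2qm^2 gives
  8m^2/5 < \<sigma>(m^2) < 2m^2. Combined with m\<sigma>(m) \<le> \<sigma>(m^2) \<le> \<sigma>(m)^2 this yields
  5m/4 < \<sigma>(m) < 2m, and the inequalities (i)-(iii) follow. If the two ratios were equal, then
  q\<sigma>(q) = m\<sigma>(m), so m divides \<sigma>(q) because q and m are coprime. As m is odd and \<sigma>(q) is even,
  \<sigma>(q) \<ge> 2m, whence q > 8m/5 and m\<sigma>(m) > 16m^2/5, contradicting \<sigma>(m) < 2m.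
\<close>

text \<open>The product map on pairs of divisors is onto but in general not injective. Overcounting
  gives the inequality \<open>sigma_mult_le\<close>; coprimality restores injectivity in
  \<open>sigma_mult_coprime\<close>.\<close>

lemma divisors_mult_nat:
  fixes a b :: nat
  shows "{d. d dvd a * b} = (\<lambda>(x, y). x * y) ` ({d. d dvd a} \<times> {d. d dvd b})"
proof (intro subset_antisym subsetI)
  fix d assume "d \<in> {d. d dvd a * b}"
  then obtain x y where "d = x * y" "x dvd a" "y dvd b"
    using division_decomp by blast
  then show "d \<in> (\<lambda>(x, y). x * y) ` ({d. d dvd a} \<times> {d. d dvd b})" by auto
qed (auto intro: mult_dvd_mono)

lemma sigma_mult_eq_sum:
  "sigma a * sigma b = (\<Sum>(x, y)\<in>{d. d dvd a} \<times> {d. d dvd b}. x * y)"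
  unfolding sigma_def by (simp add: sum_product sum.cartesian_product)

lemma sigma_mult_le:
  assumes "a > 0" "b > 0"
  shows "sigma (a * b) \<le> sigma a * sigma b"
proof -
  let ?D = "{d. d dvd a} \<times> {d. d dvd b}"
  have "sigma (a * b) = sum (\<lambda>d. d) ((\<lambda>(x, y). x * y) ` ?D)"
    unfolding sigma_def divisors_mult_nat ..
  also have "\<dots> \<le> sum ((\<lambda>d. d) \<circ> (\<lambda>(x, y). x * y)) ?D"
    using assms by (intro sum_image_le) auto
  also have "\<dots> = sigma a * sigma b"
    unfolding sigma_mult_eq_sum by (intro sum.cong) auto
  finally show ?thesis .
qed

lemma sigma_mult_coprime:
  assumes "coprime a b"
  shows "sigma (a * b) = sigma a * sigma b"
proof -
  let ?D = "{d. d dvd a} \<times> {d. d dvd b}"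
  have "inj_on (\<lambda>(x, y). x * y) ?D"
  proof (rule inj_onI, clarsimp)
    fix x y x' y'
    assume d: "x dvd a" "y dvd b" "x' dvd a" "y' dvd b" and eq: "x * y = x' * y'"
    \<comment> \<open>Each factor divides the other product but is coprime to its foreign factor, so
      it divides its counterpart; antisymmetry finishes.\<close>
    have "coprime x y'" "coprime x' y" "coprime y x'" "coprime y' x"
      using d assms coprime_divisors coprime_commute by blast+
    moreover have "x dvd x' * y'" "x' dvd x * y" "y dvd x' * y'" "y' dvd x * y"
      using eq by (metis dvd_triv_left dvd_triv_right)+
    ultimately have "x dvd x'" "x' dvd x" "y dvd y'" "y' dvd y"
      by (simp_all add: coprime_dvd_mult_left_iff coprime_dvd_mult_right_iff)
    then show "x = x' \<and> y = y'" by (simp add: dvd_antisym)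
  qed
  then have "sigma (a * b) = (\<Sum>z\<in>?D. (\<lambda>(x, y). x * y) z)"
    unfolding sigma_def divisors_mult_nat by (simp add: sum.reindex)
  then show ?thesis by (simp add: sigma_mult_eq_sum)
qed

text \<open>Multiplying the divisors of \<open>b\<close> by \<open>a\<close> gives distinct divisors
  of \<open>a * b\<close>.\<close>

lemma mult_sigma_le_sigma_mult:
  assumes "a > 0" "b > 0"
  shows "a * sigma b \<le> sigma (a * b)"
proof -
  have "a * sigma b = sum (\<lambda>d. d) ((*) a ` {d. d dvd b})"
    using assms by (simp add: sigma_def sum_distrib_left sum.reindex inj_on_def)
  also have "\<dots> \<le> sigma (a * b)"
    unfolding sigma_def using assms by (intro sum_mono2) auto
  finally show ?thesis .
qed

lemma sigma_prime_power:
  assumes "prime p"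
  shows "sigma (p ^ k) = (\<Sum>i\<le>k. p ^ i)"
proof -
  have "{d. d dvd p ^ k} = (\<lambda>i. p ^ i) ` {..k}"
    using divides_primepow_nat[OF assms] by auto
  moreover have "inj_on (\<lambda>i. p ^ i) {..k}"
    using prime_gt_1_nat[OF assms] by (auto intro!: inj_onI)
  ultimately show ?thesis by (simp add: sigma_def sum.reindex)
qed

text \<open>There are \<open>k + 1\<close> summands, an even number, and all are odd.\<close>

lemma even_sum_powers_odd:
  fixes p :: nat
  assumes "odd p" "odd k"
  shows "even (\<Sum>i\<le>k. p ^ i)"
  using assms by (simp add: even_sum_iff)

text \<open>The geometric series bounds the sum by \<open>p ^ k\<close> times p/(p-1), which is at
  most 5/4. In the induction, the factor 5 <= p absorbs the earlier terms into one extra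
  \<open>p ^ Suc k\<close>.\<close>

lemma sum_powers_less:
  fixes p :: nat
  assumes "p \<ge> 5"
  shows "4 * (\<Sum>i\<le>k. p ^ i) < 5 * p ^ k"
proof (induction k)
  case (Suc k)
  have "5 * p ^ k \<le> p ^ Suc k" using assms by simp
  moreover have "(\<Sum>i\<le>Suc k. p ^ i) = (\<Sum>i\<le>k. p ^ i) + p ^ Suc k" by simp
  ultimately show ?case using Suc by linarith
qed simp

theorem theorem4p2p4:
  fixes N p k m :: nat and \<rho>\<^sub>3 \<mu>\<^sub>4 :: real
  assumes "odd_perfect N"
    and "N = p ^ k * m\<^sup>2"
    and "prime p"
    and "[p = k] (mod 4)" and "[k = 1] (mod 4)"
    and "k > 0" and "m > 0"
    and "gcd p m = 1"
    and "\<rho>\<^sub>3 = real (sigma (p ^ k)) / real m"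
    and "\<mu>\<^sub>4 = real (sigma m) / real (p ^ k)"
  shows "\<rho>\<^sub>3 \<noteq> \<mu>\<^sub>4
    \<and> (\<rho>\<^sub>3 < 1 \<longrightarrow> p ^ k < m)
    \<and> (1 < \<rho>\<^sub>3 \<and> \<rho>\<^sub>3 < \<mu>\<^sub>4 \<longrightarrow>
         4 / 5 * real m < real (p ^ k) \<and> real (p ^ k) < sqrt 2 * real m)
    \<and> (1 < \<rho>\<^sub>3 \<and> \<mu>\<^sub>4 < \<rho>\<^sub>3 \<longrightarrow> m < p ^ k)"
proof -
  define q where "q = p ^ k"
  define s where "s = sigma q"
  define T where "T = sigma (m\<^sup>2)"
  have "p mod 4 = 1" "k mod 4 = 1"
    using assms(4,5) by (simp_all add: cong_def)
  moreover have "p \<noteq> 1" using assms(3) by auto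
  ultimately have "odd p" "odd k" "p \<ge> 5" by presburger+
  have cop: "coprime q m"
    using gcd_eq_1_imp_coprime[OF assms(8)] by (simp add: q_def)
  have m0: "m > 0" by fact
  have q0: "q > 0" using \<open>p \<ge> 5\<close> by (simp add: q_def)
  have "odd m"
    using assms(1,2) by (simp add: odd_perfect_def)
  have s_sum: "s = (\<Sum>i\<le>k. p ^ i)"
    using sigma_prime_power[OF assms(3)] by (simp add: s_def q_def)
  have "even s"
    unfolding s_sum using \<open>odd p\<close> \<open>odd k\<close> by (rule even_sum_powers_odd)
  have s_upper: "4 * s < 5 * q"
    unfolding s_sum q_def using \<open>p \<ge> 5\<close> by (rule sum_powers_less)
  have "(\<Sum>i\<le>k. p ^ i) = (\<Sum>i<k. p ^ i) + p ^ k"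
    by (simp add: lessThan_Suc_atMost[symmetric])
  moreover have "(\<Sum>i<k. p ^ i) > 0"
    using \<open>k > 0\<close> \<open>p \<ge> 5\<close> by (intro sum_pos) auto
  ultimately have s_lower: "q < s"
    by (simp add: s_sum q_def)
  have perfect: "s * T = 2 * q * m\<^sup>2"
    using assms(1,2) cop sigma_mult_coprime[of q "m\<^sup>2"]
    by (simp add: odd_perfect_def s_def T_def q_def)
  then have T0: "T > 0" using q0 m0 by (cases "T = 0") auto
  \<comment> \<open>Replace \<open>s\<close> by the smaller \<open>q\<close> in
    \<open>perfect\<close>, then cancel \<open>q\<close>.\<close>
  have "q * T < q * (2 * m\<^sup>2)"
    using mult_less_mono1[OF s_lower T0] perfect by (simp only: mult.assoc mult.left_commute)
  then have "T < 2 * m\<^sup>2" by simp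
  moreover have "m * sigma m \<le> T"
    using mult_sigma_le_sigma_mult[of m m] m0 by (simp add: T_def power2_eq_square)
  ultimately have "m * sigma m < 2 * m\<^sup>2" by linarith
  then have "m * sigma m < m * (2 * m)"
    by (simp only: power2_eq_square mult.left_commute)
  then have sm_upper: "sigma m < 2 * m" by simp
  have "4 * s * T < 5 * q * T" using s_upper T0 by simp
  then have "q * (8 * m\<^sup>2) < q * (5 * T)" using perfect by linarith
  then have "8 * m\<^sup>2 < 5 * T" by simp
  moreover have "T \<le> (sigma m)\<^sup>2"
    using sigma_mult_le[of m m] m0 by (simp add: T_def power2_eq_square)
  ultimately have sq: "8 * m\<^sup>2 < 5 * (sigma m)\<^sup>2" by simp
  \<comment> \<open>The constant 5/4 is a rational just below the square root of 8/5: (5/4)^2 =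
    25/16 < 8/5.\<close>
  have sm_lower: "5 * m < 4 * sigma m"
  proof (rule ccontr)
    assume "\<not> 5 * m < 4 * sigma m"
    then have "(4 * sigma m)\<^sup>2 \<le> (5 * m)\<^sup>2" by (intro power_mono) auto
    with sq m0 show False by (simp add: power_mult_distrib)
  qed
  have rho: "\<rho>\<^sub>3 = real s / real m" and mu: "\<mu>\<^sub>4 = real (sigma m) / real q"
    using assms(9,10) by (simp_all add: s_def q_def)
  \<comment> \<open>Clearing denominators turns every comparison of the ratios into one between
    natural numbers.\<close>
  have rho_mu_less: "\<rho>\<^sub>3 < \<mu>\<^sub>4 \<longleftrightarrow> s * q < m * sigma m"
    and mu_rho_less: "\<mu>\<^sub>4 < \<rho>\<^sub>3 \<longleftrightarrow> m * sigma m < s * q"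
    using m0 q0 by (simp_all add: rho mu field_simps flip: of_nat_mult)
  have rho_less: "\<rho>\<^sub>3 < 1 \<longleftrightarrow> s < m" and rho_greater: "1 < \<rho>\<^sub>3 \<longleftrightarrow> m < s"
    using m0 by (simp_all add: rho)

  have "s * q \<noteq> m * sigma m"
  proof
    assume eq: "s * q = m * sigma m"
    then have "m dvd s"
      using cop by (metis coprime_commute coprime_dvd_mult_left_iff dvd_triv_left)
    then obtain t where t: "s = m * t" ..
    \<comment> \<open>The odd \<open>m\<close> cannot supply the factor 2 of \<open>s\<close>, so
      the cofactor \<open>t\<close> does.\<close>
    with \<open>even s\<close> \<open>odd m\<close> have "even t" by simp
    moreover have "t \<noteq> 0" using t s_lower by (cases t) auto
    ultimately have "t \<ge> 2" by presburger
    then have s2: "2 * m \<le> s" using t by simp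
    \<comment> \<open>From 8m <= 4s < 5q. Already \<open>m < q\<close> gives sq >= 2m^2, against
      \<open>sm_upper\<close>.\<close>
    then have "m < q" using s_upper m0 by linarith
    then have "(2 * m) * m \<le> s * q" using s2 by (intro mult_mono) auto
    then have "m * (2 * m) \<le> m * sigma m" using eq by (simp add: algebra_simps)
    then show False using m0 sm_upper by simp
  qed
  then have "\<rho>\<^sub>3 \<noteq> \<mu>\<^sub>4"
    using rho_mu_less mu_rho_less by linarith
  moreover have "q < m" if "\<rho>\<^sub>3 < 1"
    using that s_lower by (simp add: rho_less)
  moreover have "4 / 5 * real m < real q \<and> real q < sqrt 2 * real m"
    if "1 < \<rho>\<^sub>3" "\<rho>\<^sub>3 < \<mu>\<^sub>4"
  proof
    \<comment> \<open>Here m < s < 5q/4.\<close>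
    show "4 / 5 * real m < real q"
      using that(1) s_upper by (simp add: rho_greater)
    \<comment> \<open>The factor sqrt 2 comes from the chain q^2 <= sq < m \<open>sigma m\<close> <=
      2m^2.\<close>
    have "q\<^sup>2 \<le> s * q" using s_lower by (simp add: power2_eq_square)
    also have "\<dots> < m * sigma m" using that(2) by (simp add: rho_mu_less)
    also have "\<dots> \<le> 2 * m\<^sup>2" using sm_upper by (simp add: power2_eq_square)
    finally have "(real q)\<^sup>2 < 2 * (real m)\<^sup>2"
      by (simp flip: of_nat_power of_nat_less_iff[where 'a = real])
    then have "(real q)\<^sup>2 < (sqrt 2 * real m)\<^sup>2" by (simp add: power_mult_distrib)
    then show "real q < sqrt 2 * real m"
      by (rule power2_less_imp_less) simp
  qed
  moreover have "m < q" if "\<mu>\<^sub>4 < \<rho>\<^sub>3"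
  proof (rule ccontr)
    assume "\<not> m < q"
    \<comment> \<open>If q <= m, then 4s < 5q <= 5m < 4 \<open>sigma m\<close>: the constant 5/4
      bounds s/q from above and \<open>sigma m\<close>/m from below, so it separates the
      two.\<close>
    then have "4 * s \<le> 4 * sigma m" "q \<le> m" using s_upper sm_lower by linarith+
    then have "s * q \<le> sigma m * m" by (intro mult_mono) auto
    with that show False by (simp add: mu_rho_less mult.commute)
  qed
  ultimately show ?thesis by (auto simp: q_def)
qed

end
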